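(* Let $L=\sum_{i=0}^N a_i(x)\partial_x^i$ be a Bochner differential operator of order $N\ge 1$ with $a_0\equiv 0$, and let $\{\delta_n^{(k)}\}$ be the sequence associated with $L$. Then $$\delta_n^{(k)}=\sum_{i=k}^{N}(-1)^{N-i}\binom{n}{i}\binom{n-i-1}{N-i}\delta_i^{(k)}\qquad\text{for all } n\ge N+1 \text{ and } 0\le k\le N,$$ and $$\delta_n^{(k)}=0\qquad\text{for all } n\ge k>N.$$
   Context: A Bochner differential operator of order $N$ is an operator $L=\sum_{i=0}^N a_i(x)\partial_x^i$, where each $a_i(x)$ is a polynomial with complex coefficients, $\deg a_i\le i$, and $\partial_x^i$ is the $i$-th derivative with respect to $x$. Set $a_n(x)=0$ for $n>N$ and write $a_n(x)=\sum_{i=0}^n a_{n,i}x^i$ with $a_{n,i}\in\mathbb{C}$. The sequence $\{\delta_n^{(k)}\}$ associated with $L$ is $$\delta_n^{(k)}=\sum_{i=k}^{n}\binom{n}{i}\,i!\,a_{i,i-k},\quad n=0,1,2,\dots,\ k=0,1,\dots,n,$$ and $\delta_n^{(k)}=0$ for $k>n$. *)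

theory Defs
  imports Complex_Main "HOL-Computational_Algebra.Polynomial"
begin

(* L = sum_{i <= N} a_i(x) d^i/dx^i, acting on complex polynomials, given together with
   its coefficients.  The coefficient sequence is extended by a_n = 0 for n > N; a_N is
   not required to be nonzero. *)
definition bochner_operator ::
    "nat \<Rightarrow> (nat \<Rightarrow> complex poly) \<Rightarrow> (complex poly \<Rightarrow> complex poly) \<Rightarrow> bool" where
  "bochner_operator N a L \<longleftrightarrow>
     (\<forall>i\<le>N. degree (a i) \<le> i) \<and>
     (\<forall>n>N. a n = 0) \<and>
     (\<forall>p. L p = (\<Sum>i=0..N. a i * (pderiv ^^ i) p))"

(* assoc_seq a k n is delta_n^(k). *)
definition assoc_seq :: "(nat \<Rightarrow> complex poly) \<Rightarrow> nat \<Rightarrow> nat \<Rightarrow> complex" where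
  "assoc_seq a k n =
     (if k \<le> n
      then (\<Sum>i=k..n. of_nat (n choose i) * fact i * coeff (a i) (i - k))
      else 0)"

end

theory Submission
  imports Defs "HOL-Computational_Algebra.Formal_Power_Series"
begin

text \<open>
  As a function of \<open>n\<close>, the sequence \<open>\<delta>\<close> for fixed \<open>k\<close> is a combination
  \<open>\<Sum>j\<le>N. (n choose j) * c j\<close> of binomial coefficients, because \<open>a j = 0\<close> for
  \<open>j > N\<close>; that is, a polynomial in \<open>n\<close> of degree at most \<open>N\<close>.  Such a polynomial is
  determined by its values at \<open>0, \<dots>, N\<close>, and the asserted formula is Lagrange
  interpolation at these nodes: for \<open>n > N\<close> the Lagrange basis polynomial of the node
  \<open>i\<close> has the value \<open>(-1) ^ (N - i) * (n choose i) * ((n - i - 1) choose (N - i))\<close>.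
  The terms with \<open>i < k\<close> are absent because \<open>\<delta>\<close> vanishes there.

  By linearity it suffices to interpolate a single \<open>n choose j\<close>
  (lemma \<open>choose_interpolation\<close>).  Trinomial revision pulls out the factor
  \<open>n choose j\<close>, and what remains is an alternating sum equal to \<open>1\<close>
  (lemma \<open>alternating_choose_sum\<close>), an instance of Vandermonde's identity with a
  negative upper index.
\<close>

text \<open>
  Negating the upper index turns \<open>(-1) ^ (M - r) * ((m - r - 1) choose (M - r))\<close> into
  \<open>(M - m) gchoose (M - r)\<close>, whose upper index no longer depends on \<open>r\<close>.  The sum is
  then a Vandermonde convolution with value \<open>(m + (M - m)) gchoose M = 1\<close>.
\<close>

lemma alternating_choose_sum:
  assumes "M < m"
  shows "(\<Sum>r=0..M. (-1) ^ (M - r) * of_nat (m choose r) *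
            of_nat ((m - r - 1) choose (M - r))) = (1 :: 'a :: field_char_0)"
proof -
  have negated: "(-1) ^ (M - r) * of_nat ((m - r - 1) choose (M - r))
                   = ((of_nat M - of_nat m) gchoose (M - r) :: 'a)"
    if "r \<le> M" for r
  proof -
    have "of_nat (M - r) - (of_nat M - of_nat m) - 1 = (of_nat (m - r - 1) :: 'a)"
      using that assms by (simp add: of_nat_diff)
    then show ?thesis
      by (subst gbinomial_negated_upper) (simp add: binomial_gbinomial)
  qed
  have "(\<Sum>r=0..M. (-1) ^ (M - r) * of_nat (m choose r) *
            of_nat ((m - r - 1) choose (M - r)))
        = (\<Sum>r=0..M. (of_nat m gchoose r) *
            ((of_nat M - of_nat m) gchoose (M - r)) :: 'a)"
    by (rule sum.cong) (simp_all add: negated[symmetric] binomial_gbinomial[symmetric] mult_ac)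
  also have "\<dots> = ((of_nat m + (of_nat M - of_nat m)) gchoose M)"
    by (rule gbinomial_Vandermonde)
  also have "\<dots> = of_nat (M choose M)"
    by (simp add: binomial_gbinomial del: binomial_n_n)
  finally show ?thesis
    by simp
qed

text \<open>
  Since \<open>(n choose i) * (i choose j) = (n choose j) * ((n - j) choose (i - j))\<close>, the
  shift \<open>i = r + j\<close> reduces this to the preceding identity with \<open>n - j\<close> and
  \<open>N - j\<close> in place of \<open>m\<close> and \<open>M\<close>.
\<close>

lemma choose_interpolation:
  assumes "j \<le> N" "N < n"
  shows "(\<Sum>i=0..N. (-1) ^ (N - i) * of_nat (n choose i) *
            of_nat ((n - i - 1) choose (N - i)) * of_nat (i choose j))
         = (of_nat (n choose j) :: 'a :: field_char_0)"
    (is "sum ?t _ = _")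
proof -
  have "sum ?t {0..N} = sum ?t {0 + j..(N - j) + j}"
    using assms by (intro sum.mono_neutral_right) auto
  also have "\<dots> = (\<Sum>r=0..N - j. ?t (r + j))"
    by (rule sum.shift_bounds_cl_nat_ivl)
  also have "\<dots> = (\<Sum>r=0..N - j. of_nat (n choose j) *
      ((-1) ^ (N - j - r) * of_nat ((n - j) choose r) *
        of_nat ((n - j - r - 1) choose (N - j - r))))"
  proof (rule sum.cong)
    fix r assume "r \<in> {0..N - j}"
    then have "(n choose (r + j)) * ((r + j) choose j) = (n choose j) * ((n - j) choose r)"
      using assms choose_mult[of j "r + j" n] by simp
    then have revision: "of_nat (n choose (r + j)) * of_nat ((r + j) choose j)
                 = (of_nat (n choose j) * of_nat ((n - j) choose r) :: 'a)"
      by (metis of_nat_mult)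
    have shifts: "N - (r + j) = N - j - r" "n - (r + j) - 1 = n - j - r - 1"
      by simp_all
    have regroup: "s * x * y * z = (x * z) * (s * y)" for s x y z :: 'a
      by (simp only: mult_ac)
    show "?t (r + j) = of_nat (n choose j) *
      ((-1) ^ (N - j - r) * of_nat ((n - j) choose r) *
        of_nat ((n - j - r - 1) choose (N - j - r)))"
      unfolding shifts regroup revision by (simp only: mult_ac)
  qed simp
  also have "\<dots> = of_nat (n choose j) * 1"
    using assms by (subst sum_distrib_left[symmetric], subst alternating_choose_sum) auto
  finally show ?thesis
    by simp
qed

text \<open>
  The range of summation can be made independent of \<open>n\<close>: the terms added for \<open>i > n\<close> vanish with
  \<open>n choose i\<close>, those dropped for \<open>i > N\<close> vanish with \<open>a i\<close>.  If \<open>n < k\<close>, all terms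
  are of the first kind, which matches the default value \<open>0\<close> of the sequence.
\<close>

lemma assoc_seq_eq_sum:
  assumes "\<forall>i>N. a i = 0"
  shows "assoc_seq a k n
         = (\<Sum>i=k..N. of_nat (n choose i) * (fact i * coeff (a i) (i - k)))"
proof -
  let ?g = "\<lambda>i. of_nat (n choose i) * (fact i * coeff (a i) (i - k))"
  have "assoc_seq a k n = sum ?g {k..n}"
    by (simp add: assoc_seq_def mult.assoc)
  also have "\<dots> = sum ?g {k..max n N}"
    by (rule sum.mono_neutral_left) auto
  also have "\<dots> = sum ?g {k..N}"
    using assms by (intro sum.mono_neutral_right) auto
  finally show ?thesis .
qed

theorem theorem4:
  fixes N :: nat
    and a :: "nat \<Rightarrow> complex poly"
    and L :: "complex poly \<Rightarrow> complex poly"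
    and \<delta> :: "nat \<Rightarrow> nat \<Rightarrow> complex"
  assumes "N \<ge> 1"
    and "bochner_operator N a L"
    and "a 0 = 0"
    and "\<And>k n. \<delta> k n = assoc_seq a k n"
  shows "(\<forall>n k. n \<ge> N + 1 \<and> k \<le> N \<longrightarrow>
            \<delta> k n = (\<Sum>i=k..N. (-1) ^ (N - i) * of_nat (n choose i)
                        * of_nat ((n - i - 1) choose (N - i)) * \<delta> k i))
       \<and> (\<forall>n k. n \<ge> k \<and> k > N \<longrightarrow> \<delta> k n = 0)"
proof -
  define c where "c k i = fact i * coeff (a i) (i - k)" for k i
  have \<delta>_eq: "\<delta> k n = (\<Sum>j=k..N. of_nat (n choose j) * c k j)" for k n
    using assms(2) unfolding assms(4) c_def
    by (intro assoc_seq_eq_sum) (simp add: bochner_operator_def)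
  have "\<delta> k n = (\<Sum>i=k..N. (-1) ^ (N - i) * of_nat (n choose i)
                   * of_nat ((n - i - 1) choose (N - i)) * \<delta> k i)"
    if "N < n" for n k
  proof -
    define w where
      "w i = ((-1) ^ (N - i) * of_nat (n choose i) * of_nat ((n - i - 1) choose (N - i))
                :: complex)" for i
    have "(\<Sum>i=k..N. w i * \<delta> k i) = (\<Sum>i=0..N. w i * \<delta> k i)"
      by (rule sum.mono_neutral_left) (auto simp: assms(4) assoc_seq_def)
    also have "\<dots> = (\<Sum>i=0..N. \<Sum>j=k..N. w i * of_nat (i choose j) * c k j)"
      by (simp add: \<delta>_eq sum_distrib_left mult.assoc)
    also have "\<dots> = (\<Sum>j=k..N. (\<Sum>i=0..N. w i * of_nat (i choose j)) * c k j)"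
      by (subst sum.swap) (simp add: sum_distrib_right)
    also have "\<dots> = (\<Sum>j=k..N. of_nat (n choose j) * c k j)"
      unfolding w_def using that by (intro sum.cong refl) (subst choose_interpolation; simp)
    also have "\<dots> = \<delta> k n"
      by (simp add: \<delta>_eq)
    finally show ?thesis
      by (simp add: w_def)
  qed
  moreover have "\<delta> k n = 0" if "N < k" for n k
    using that by (simp add: \<delta>_eq)
  ultimately show ?thesis
    by simp
qed

end
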